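(* Let $\mathcal{X}\subseteq\mathbb{R}^n$ be closed and convex, and let $f:\mathcal{X}\to\mathbb{R}$ be continuously differentiable, $L$-smooth and $\mu$-strongly convex with respect to the Euclidean norm $\|\cdot\|=\|\cdot\|_2$, where $0<\mu\le L<\infty$, with minimizer $\mathbf{x}_*$. Let $\psi(\mathbf{x})=\frac{L-\mu}{2}\|\mathbf{x}\|^2$, $a_1=1$, $\frac{a_i}{A_i}=\gamma_i\le\sqrt{\frac{\mu}{L}}$ for $i\ge2$, and let $\mathbf{x}_k,\mathbf{y}_k,\mathbf{v}_k$ evolve according to the $\mu$AGD+ algorithm (defined in the context) from an arbitrary $\mathbf{x}_0\in\mathcal{X}$ with oracle errors $\boldsymbol{\eta}_k$. Then for all $k\ge1$: $$f(\mathbf{y}_k)-f(\mathbf{x}_* )\le\frac{A_1}{A_k}\cdot\frac{(L-\mu)\|\mathbf{x}_*-\mathbf{x}_0\|^2}{2}+\frac{\sum_{i=1}^k a_i\langle\boldsymbol{\eta}_i,\mathbf{x}_*-\mathbf{v}_i\rangle}{A_k}$$ $$\le\left(\prod_{i=2}^k(1-\gamma_i)\right)\frac{(L-\mu)\|\mathbf{x}_*-\mathbf{x}_0\|^2}{2}+\frac{\sum_{i=1}^k a_i\langle\boldsymbol{\eta}_i,\mathbf{x}_*-\mathbf{v}_i\rangle}{A_k}.$$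
   Context: $L$-smooth: $f(\hat{\mathbf{x}})\le f(\mathbf{x})+\langle\nabla f(\mathbf{x}),\hat{\mathbf{x}}-\mathbf{x}\rangle+\frac{L}{2}\|\hat{\mathbf{x}}-\mathbf{x}\|^2$ for all $\mathbf{x},\hat{\mathbf{x}}\in\mathcal{X}$; $\mu$-strongly convex: $f(\hat{\mathbf{x}})\ge f(\mathbf{x})+\langle\nabla f(\mathbf{x}),\hat{\mathbf{x}}-\mathbf{x}\rangle+\frac{\mu}{2}\|\hat{\mathbf{x}}-\mathbf{x}\|^2$ for all $\mathbf{x},\hat{\mathbf{x}}\in\mathcal{X}$. Bregman divergence: $D_\psi(\mathbf{x},\hat{\mathbf{x}})=\psi(\mathbf{x})-\psi(\hat{\mathbf{x}})-\langle\nabla\psi(\hat{\mathbf{x}}),\mathbf{x}-\hat{\mathbf{x}}\rangle$. $\mu$AGD+ algorithm: $a_k>0$ ($k\ge1$), $A_k=\sum_{i=1}^k a_i$, $A_0=0$, $\theta_k=\frac{a_k}{A_k}$. A gradient oracle queried at $\mathbf{x}_k$ returns $\widetilde{\nabla}f(\mathbf{x}_k)=\nabla f(\mathbf{x}_k)+\boldsymbol{\eta}_k$. Define $$m_k(\mathbf{u})=\sum_{i=1}^k a_i\left(\langle\widetilde{\nabla}f(\mathbf{x}_i),\mathbf{u}-\mathbf{x}_i\rangle+\tfrac{\mu}{2}\|\mathbf{u}-\mathbf{x}_i\|^2\right)+D_\psi(\mathbf{u},\mathbf{x}_0).$$ Initialize $\mathbf{x}_1=\mathbf{x}_0=\mathbf{y}_0=\mathbf{v}_0\in\mathcal{X}$.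 For $k\ge1$: $$\mathbf{x}_k=\tfrac{1}{1+\theta_k}\mathbf{y}_{k-1}+\tfrac{\theta_k}{1+\theta_k}\mathbf{v}_{k-1},\quad \mathbf{v}_k=\arg\min_{\mathbf{u}\in\mathcal{X}}m_k(\mathbf{u}),\quad \mathbf{y}_k=(1-\theta_k)\mathbf{y}_{k-1}+\theta_k\mathbf{v}_k.$$ *)

theory Defs
  imports "HOL-Analysis.Analysis"
begin

text \<open>A function \<open>f : X \<rightarrow> \<real>\<close> is modelled by a total function of which only the values on \<open>X\<close>
  are used. The gradient is a vector field \<open>g\<close> on \<open>X\<close>, where differentiability is relative to
  \<open>X\<close>, so that boundary points of \<open>X\<close> are covered. Where the derivative relative to \<open>X\<close> does not
  determine the gradient (e.g. if \<open>X\<close> has empty interior), \<open>g\<close> is any continuous choice.\<close>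

definition cont_diff_on :: "(real^'n) set \<Rightarrow> (real^'n \<Rightarrow> real) \<Rightarrow> (real^'n \<Rightarrow> real^'n) \<Rightarrow> bool" where
  "cont_diff_on X f g \<longleftrightarrow>
     (\<forall>x\<in>X. (f has_derivative (\<lambda>h. g x \<bullet> h)) (at x within X)) \<and> continuous_on X g"

definition smooth_fun_on ::
    "real \<Rightarrow> (real^'n) set \<Rightarrow> (real^'n \<Rightarrow> real) \<Rightarrow> (real^'n \<Rightarrow> real^'n) \<Rightarrow> bool" where
  "smooth_fun_on L X f g \<longleftrightarrow>
     (\<forall>x\<in>X. \<forall>z\<in>X. f z \<le> f x + g x \<bullet> (z - x) + L / 2 * (norm (z - x))\<^sup>2)"

definition strongly_convex_fun_on ::
    "real \<Rightarrow> (real^'n) set \<Rightarrow> (real^'n \<Rightarrow> real) \<Rightarrow> (real^'n \<Rightarrow> real^'n) \<Rightarrow> bool" where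
  "strongly_convex_fun_on \<mu> X f g \<longleftrightarrow>
     (\<forall>x\<in>X. \<forall>z\<in>X. f z \<ge> f x + g x \<bullet> (z - x) + \<mu> / 2 * (norm (z - x))\<^sup>2)"

definition gradient :: "(real^'n \<Rightarrow> real) \<Rightarrow> real^'n \<Rightarrow> real^'n" where
  "gradient \<psi> x = (THE d. GDERIV \<psi> x :> d)"

definition bregman :: "(real^'n \<Rightarrow> real) \<Rightarrow> real^'n \<Rightarrow> real^'n \<Rightarrow> real" where
  "bregman \<psi> x z = \<psi> x - \<psi> z - gradient \<psi> z \<bullet> (x - z)"

definition cumul :: "(nat \<Rightarrow> real) \<Rightarrow> nat \<Rightarrow> real" where
  "cumul a k = (\<Sum>i=1..k. a i)"

text \<open>The function \<open>m\<^sub>k\<close>; here \<open>gt i\<close> is the answer of the gradient oracle to the query \<open>x i\<close>.\<close>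

definition agd_model ::
    "(real^'n \<Rightarrow> real) \<Rightarrow> real \<Rightarrow> (nat \<Rightarrow> real) \<Rightarrow> (nat \<Rightarrow> real^'n) \<Rightarrow> (nat \<Rightarrow> real^'n) \<Rightarrow>
     nat \<Rightarrow> real^'n \<Rightarrow> real" where
  "agd_model \<psi> \<mu> a gt x k u =
     (\<Sum>i=1..k. a i * (gt i \<bullet> (u - x i) + \<mu> / 2 * (norm (u - x i))\<^sup>2)) + bregman \<psi> u (x 0)"

text \<open>The sequences \<open>x\<close>, \<open>y\<close>, \<open>v\<close> are produced by \<open>\<mu>\<close>AGD+ with step sizes \<open>a\<close>, gradient \<open>g\<close> and
  oracle errors \<open>\<eta>\<close>. The values \<open>a 0\<close> and \<open>\<eta> 0\<close> are irrelevant.\<close>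

definition mu_agd_plus ::
    "(real^'n) set \<Rightarrow> (real^'n \<Rightarrow> real) \<Rightarrow> real \<Rightarrow> (nat \<Rightarrow> real) \<Rightarrow> (real^'n \<Rightarrow> real^'n) \<Rightarrow>
     (nat \<Rightarrow> real^'n) \<Rightarrow> (nat \<Rightarrow> real^'n) \<Rightarrow> (nat \<Rightarrow> real^'n) \<Rightarrow> (nat \<Rightarrow> real^'n) \<Rightarrow> bool" where
  "mu_agd_plus X \<psi> \<mu> a g \<eta> x y v \<longleftrightarrow>
     (\<forall>k\<ge>1. a k > 0) \<and>
     x 0 \<in> X \<and> x 1 = x 0 \<and> y 0 = x 0 \<and> v 0 = x 0 \<and>
     (\<forall>k\<ge>1. let \<theta> = a k / cumul a k in
        x k = (1 / (1 + \<theta>)) *\<^sub>R y (k - 1) + (\<theta> / (1 + \<theta>)) *\<^sub>R v (k - 1) \<and>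
        is_arg_min (agd_model \<psi> \<mu> a (\<lambda>i. g (x i) + \<eta> i) x k) (\<lambda>u. u \<in> X) (v k) \<and>
        y k = (1 - \<theta>) *\<^sub>R y (k - 1) + \<theta> *\<^sub>R v k)"

end

theory Submission
  imports Defs
begin

text \<open>Let \<open>A\<^sub>k = cumul a k\<close>. The model \<open>m\<^sub>k\<close> is quadratic with curvature \<open>A\<^sub>k \<mu> + (L - \<mu>)\<close>, so it exceeds
  its minimum on \<open>X\<close> by at least half the curvature times the squared distance to \<open>v\<^sub>k\<close>. With
  smoothness at \<open>x\<^sub>k\<close> and strong convexity between \<open>x\<^sub>k\<close> and \<open>y\<^sub>k\<^sub>-\<^sub>1\<close>, induction shows that
  \<open>A\<^sub>k f(y\<^sub>k)\<close> is at most \<open>m\<^sub>k(v\<^sub>k) + \<Sum> a\<^sub>i (f(x\<^sub>i) - \<langle>\<eta>\<^sub>i, v\<^sub>i - x\<^sub>i\<rangle>)\<close>. The quadratic error terms are absorbed because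
  \<open>y\<^sub>k - x\<^sub>k\<close> is \<open>\<theta>\<^sub>k\<close> times a convex combination of \<open>v\<^sub>k - v\<^sub>k\<^sub>-\<^sub>1\<close> and \<open>v\<^sub>k - x\<^sub>k\<close>, and \<open>L \<theta>\<^sub>k\<^sup>2 \<le> \<mu>\<close>.
  Bounding \<open>m\<^sub>k(v\<^sub>k)\<close> by \<open>m\<^sub>k(x\<^sub>*)\<close> and using strong convexity at \<open>x\<^sub>*\<close> gives the first inequality; the second
  is an equality, since \<open>A\<^sub>i\<^sub>-\<^sub>1 / A\<^sub>i = 1 - \<gamma>\<^sub>i\<close>.\<close>

text \<open>Kept as an identity, valid for every real \<open>t\<close>: the last term gives the
  exact curvature of the model, and dropping it for \<open>t\<close> in [0,1] gives convexity of the
  squared norm.\<close>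

lemma norm_affine_combination:
  fixes p q :: "'a::real_inner"
  shows "(norm ((1 - t) *\<^sub>R p + t *\<^sub>R q))\<^sup>2
    = (1 - t) * (norm p)\<^sup>2 + t * (norm q)\<^sup>2 - t * (1 - t) * (norm (q - p))\<^sup>2"
  unfolding power2_norm_eq_inner by (simp add: inner_simps inner_commute algebra_simps)

text \<open>\<open>quad\<close> says that \<open>m\<close> has curvature \<open>s\<close> along the
  line through \<open>v\<close> and \<open>u\<close>. Comparing \<open>v\<close> with a point of the
  segment and cancelling a factor \<open>t\<close> leaves growth with constant
  \<open>(1 - t) * s / 2\<close>; then \<open>t\<close> tends to 0. No first-order optimality
  condition enters.\<close>

lemma argmin_quadratic_growth:
  fixes m :: "'a::real_normed_vector \<Rightarrow> real"
  assumes X: "convex X" and min: "is_arg_min m (\<lambda>u. u \<in> X) v" and u: "u \<in> X"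
    and quad: "\<And>t. m ((1 - t) *\<^sub>R v + t *\<^sub>R u)
                 = (1 - t) * m v + t * m u - t * (1 - t) * (s / 2 * (norm (u - v))\<^sup>2)"
  shows "m v + s / 2 * (norm (u - v))\<^sup>2 \<le> m u"
proof -
  define q where "q = s / 2 * (norm (u - v))\<^sup>2"
  have v: "v \<in> X" and le: "\<And>w. w \<in> X \<Longrightarrow> m v \<le> m w"
    using min by (auto simp: is_arg_min_def not_less)
  have bound: "m v + (1 - t) * q \<le> m u" if t: "0 < t" "t < 1" for t
  proof -
    have "(1 - t) *\<^sub>R v + t *\<^sub>R u \<in> X"
      using X v u t by (simp add: convex_alt)
    then have "m v \<le> (1 - t) * m v + t * m u - t * (1 - t) * q"
      using le quad q_def by metis
    then have "t * (m v + (1 - t) * q) \<le> t * m u"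
      by (simp add: algebra_simps)
    with t show ?thesis by simp
  qed
  have "((\<lambda>t. m v + (1 - t) * q) \<longlongrightarrow> m v + (1 - 0) * q) (at_right 0)"
    by (intro tendsto_intros)
  moreover have "\<forall>\<^sub>F t in at_right 0. m v + (1 - t) * q \<le> m u"
    using eventually_at_right_real[of 0 1] by (auto elim!: eventually_mono intro!: bound)
  ultimately have "m v + (1 - 0) * q \<le> m u"
    by (intro tendsto_upperbound) auto
  then show ?thesis by (simp add: q_def)
qed

lemma gradient_half_norm_squared:
  assumes "\<And>z. \<psi> z = c / 2 * (norm z)\<^sup>2"
  shows "gradient \<psi> z = c *\<^sub>R z"
proof -
  have "\<psi> = (\<lambda>z. c / 2 * (z \<bullet> z))"
    using assms by (auto simp: power2_norm_eq_inner)
  moreover have "((\<lambda>z. c / 2 * (z \<bullet> z)) has_derivative (\<lambda>h. c / 2 * (z \<bullet> h + h \<bullet> z))) (at z)"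
    by (intro derivative_intros)
  ultimately have "GDERIV \<psi> z :> c *\<^sub>R z"
    by (simp add: gderiv_def inner_commute)
  \<comment> \<open>\<open>gradient\<close> is a definite description, so uniqueness of the
    derivative vector is required too.\<close>
  moreover have "d = e" if "GDERIV \<psi> z :> d" "GDERIV \<psi> z :> e" for d e
    using has_derivative_unique[OF that[unfolded gderiv_def]]
    by (metis inner_commute vector_eq_ldot)
  ultimately show ?thesis
    unfolding gradient_def by blast
qed

lemma bregman_half_norm_squared:
  assumes "\<And>z. \<psi> z = c / 2 * (norm z)\<^sup>2"
  shows "bregman \<psi> w z = c / 2 * (norm (w - z))\<^sup>2"
  unfolding bregman_def gradient_half_norm_squared[of \<psi> c, OF assms] assms
  by (simp add: power2_norm_eq_inner inner_simps inner_commute field_simps)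

text \<open>Linear terms are affine in the argument, so only squared norms leave a defect:
  \<open>a i * \<mu>\<close> from each summand and \<open>c\<close> from the Bregman term.\<close>

lemma agd_model_affine_combination:
  assumes "\<And>z. \<psi> z = c / 2 * (norm z)\<^sup>2"
  shows "agd_model \<psi> \<mu> a gt x k ((1 - t) *\<^sub>R v + t *\<^sub>R u)
    = (1 - t) * agd_model \<psi> \<mu> a gt x k v + t * agd_model \<psi> \<mu> a gt x k u
      - t * (1 - t) * ((cumul a k * \<mu> + c) / 2 * (norm (u - v))\<^sup>2)"
proof -
  have n: "(norm ((1 - t) *\<^sub>R v + t *\<^sub>R u - p))\<^sup>2
      = (1 - t) * (norm (v - p))\<^sup>2 + t * (norm (u - p))\<^sup>2 - t * (1 - t) * (norm (u - v))\<^sup>2" for p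
    using norm_affine_combination[of t "v - p" "u - p"] by (simp add: algebra_simps)
  have "a i * (gt i \<bullet> ((1 - t) *\<^sub>R v + t *\<^sub>R u - x i)
          + \<mu> / 2 * (norm ((1 - t) *\<^sub>R v + t *\<^sub>R u - x i))\<^sup>2)
      = (1 - t) * (a i * (gt i \<bullet> (v - x i) + \<mu> / 2 * (norm (v - x i))\<^sup>2))
        + t * (a i * (gt i \<bullet> (u - x i) + \<mu> / 2 * (norm (u - x i))\<^sup>2))
        - a i * (t * (1 - t) * \<mu> / 2 * (norm (u - v))\<^sup>2)" for i
    unfolding n by (simp add: inner_simps field_simps)
  then have "(\<Sum>i=1..k. a i * (gt i \<bullet> ((1 - t) *\<^sub>R v + t *\<^sub>R u - x i)
          + \<mu> / 2 * (norm ((1 - t) *\<^sub>R v + t *\<^sub>R u - x i))\<^sup>2))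
      = (1 - t) * (\<Sum>i=1..k. a i * (gt i \<bullet> (v - x i) + \<mu> / 2 * (norm (v - x i))\<^sup>2))
        + t * (\<Sum>i=1..k. a i * (gt i \<bullet> (u - x i) + \<mu> / 2 * (norm (u - x i))\<^sup>2))
        - cumul a k * (t * (1 - t) * \<mu> / 2 * (norm (u - v))\<^sup>2)"
    by (simp only: sum.distrib sum_subtractf sum_distrib_left sum_distrib_right cumul_def)
  then show ?thesis
    unfolding agd_model_def bregman_half_norm_squared[of \<psi> c, OF assms] n
    by (simp add: field_simps)
qed

lemma agd_model_Suc:
  "agd_model \<psi> \<mu> a gt x (Suc k) u
    = agd_model \<psi> \<mu> a gt x k u
      + a (Suc k) * (gt (Suc k) \<bullet> (u - x (Suc k)) + \<mu> / 2 * (norm (u - x (Suc k)))\<^sup>2)"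
  by (simp add: agd_model_def)

lemma cumul_Suc: "cumul a (Suc k) = cumul a k + a (Suc k)"
  by (simp add: cumul_def)

text \<open>The weights defining \<open>x\<close> are such that, once \<open>y\<close> is
  eliminated, \<open>y' - x\<close> carries a factor \<open>\<theta>\<close> in front of a convex
  combination. Squared, this factor trades \<open>L\<close> for \<open>\<mu>\<close>.\<close>

lemma agd_step_residuals:
  fixes x y v w y' :: "'a::real_inner"
  assumes "0 \<le> \<theta>" "\<theta> \<le> 1" "0 \<le> \<mu>" "L * \<theta>\<^sup>2 \<le> \<mu>"
    and x: "x = (1 / (1 + \<theta>)) *\<^sub>R y + (\<theta> / (1 + \<theta>)) *\<^sub>R v"
    and y': "y' = (1 - \<theta>) *\<^sub>R y + \<theta> *\<^sub>R w"
  shows "L * (norm (y' - x))\<^sup>2 \<le> \<mu> * ((1 - \<theta>) * (norm (w - v))\<^sup>2 + \<theta> * (norm (w - x))\<^sup>2)"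
proof -
  have "(1 + \<theta>) *\<^sub>R x = y + \<theta> *\<^sub>R v"
    using assms(1) by (simp add: x scaleR_add_right)
  then have y: "y = x + \<theta> *\<^sub>R x - \<theta> *\<^sub>R v"
    by (simp add: algebra_simps)
  have res: "y' - x = \<theta> *\<^sub>R ((1 - \<theta>) *\<^sub>R (w - v) + \<theta> *\<^sub>R (w - x))"
    unfolding y' y by (simp add: algebra_simps)
  define p where "p = (1 - \<theta>) *\<^sub>R (w - v) + \<theta> *\<^sub>R (w - x)"
  have "L * (norm (y' - x))\<^sup>2 = L * \<theta>\<^sup>2 * (norm p)\<^sup>2"
    using res by (simp add: p_def power_mult_distrib)
  also have "\<dots> \<le> \<mu> * (norm p)\<^sup>2"
    using assms(4) by (rule mult_right_mono) simp
  also have "\<dots> \<le> \<mu> * ((1 - \<theta>) * (norm (w - v))\<^sup>2 + \<theta> * (norm (w - x))\<^sup>2)"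
    using assms(1-3) unfolding p_def norm_affine_combination
    by (intro mult_left_mono) simp_all
  finally show ?thesis .
qed

text \<open>One iteration, with \<open>B\<close> the weight accumulated so far and \<open>b\<close>
  the new one. The smoothness bound at \<open>x\<close> is split by these weights: the
  \<open>B\<close> part of its linearization lies below \<open>f y\<close>, the \<open>b\<close>
  part is the new summand of the model. The remaining distance from \<open>w\<close> to
  \<open>v\<close> is left for the growth of the old model to pay.\<close>

lemma agd_function_decrease:
  assumes smooth: "smooth_fun_on L X f g" and sc: "strongly_convex_fun_on \<mu> X f g"
    and X: "x \<in> X" "y \<in> X" "y' \<in> X"
    and "0 \<le> \<mu>" "0 \<le> B" "0 < b" "\<theta> = b / (B + b)" "L * \<theta>\<^sup>2 \<le> \<mu>"
    and x: "x = (1 / (1 + \<theta>)) *\<^sub>R y + (\<theta> / (1 + \<theta>)) *\<^sub>R v"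
    and y': "y' = (1 - \<theta>) *\<^sub>R y + \<theta> *\<^sub>R w"
  shows "(B + b) * f y' \<le> B * f y + b * (f x + g x \<bullet> (w - x) + \<mu> / 2 * (norm (w - x))\<^sup>2)
    + B * \<mu> / 2 * (norm (w - v))\<^sup>2"
proof -
  have \<theta>: "0 \<le> \<theta>" "\<theta> \<le> 1" and b: "(B + b) * \<theta> = b"
    using assms(7-9) by simp_all
  then have B: "(B + b) * (1 - \<theta>) = B"
    by (simp add: right_diff_distrib)
  have lin: "(B + b) * (g x \<bullet> (y' - x)) = B * (g x \<bullet> (y - x)) + b * (g x \<bullet> (w - x))"
  proof -
    have "y' - x = (1 - \<theta>) *\<^sub>R (y - x) + \<theta> *\<^sub>R (w - x)"
      unfolding y' by (simp add: algebra_simps)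
    then have "(B + b) * (g x \<bullet> (y' - x))
        = ((B + b) * (1 - \<theta>)) * (g x \<bullet> (y - x)) + ((B + b) * \<theta>) * (g x \<bullet> (w - x))"
      by (simp only: inner_add_right inner_scaleR_right distrib_left mult.assoc)
    then show ?thesis by (simp only: b B)
  qed
  have "f y' \<le> f x + g x \<bullet> (y' - x) + L / 2 * (norm (y' - x))\<^sup>2"
    using smooth X by (auto simp: smooth_fun_on_def)
  also have "\<dots> \<le> f x + g x \<bullet> (y' - x)
      + \<mu> / 2 * ((1 - \<theta>) * (norm (w - v))\<^sup>2 + \<theta> * (norm (w - x))\<^sup>2)"
    using agd_step_residuals[OF \<theta> assms(6) assms(10) x y'] by simp
  finally have "(B + b) * f y' \<le> (B + b) * (f x + g x \<bullet> (y' - x)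
      + \<mu> / 2 * ((1 - \<theta>) * (norm (w - v))\<^sup>2 + \<theta> * (norm (w - x))\<^sup>2))"
    using assms(7,8) by (intro mult_left_mono) auto
  also have "\<dots> = (B + b) * f x + (B + b) * (g x \<bullet> (y' - x))
      + \<mu> / 2 * (((B + b) * (1 - \<theta>)) * (norm (w - v))\<^sup>2 + ((B + b) * \<theta>) * (norm (w - x))\<^sup>2)"
    by (simp add: field_simps)
  also have "\<dots> = B * (f x + g x \<bullet> (y - x))
      + b * (f x + g x \<bullet> (w - x) + \<mu> / 2 * (norm (w - x))\<^sup>2) + B * \<mu> / 2 * (norm (w - v))\<^sup>2"
    unfolding lin b B by (simp add: algebra_simps)
  also have "B * (f x + g x \<bullet> (y - x)) \<le> B * f y"
  proof (rule mult_left_mono[OF _ assms(7)])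
    have "f x + g x \<bullet> (y - x) + \<mu> / 2 * (norm (y - x))\<^sup>2 \<le> f y"
      using sc X by (auto simp: strongly_convex_fun_on_def)
    moreover have "0 \<le> \<mu> / 2 * (norm (y - x))\<^sup>2"
      using assms(6) by simp
    ultimately show "f x + g x \<bullet> (y - x) \<le> f y" by linarith
  qed
  finally show ?thesis by simp
qed

lemma cumul_pos:
  assumes "\<forall>k\<ge>1. a k > 0" "k \<ge> 1"
  shows "cumul a k > 0"
  unfolding cumul_def using assms by (intro sum_pos) auto

lemma prod_one_minus_ratio_cumul:
  assumes pos: "\<forall>k\<ge>1. a k > 0" and k: "k \<ge> 1"
    and \<gamma>: "\<And>i. i \<ge> 2 \<Longrightarrow> a i / cumul a i = \<gamma> i"
  shows "(\<Prod>i=2..k. (1 - \<gamma> i)) = cumul a 1 / cumul a k"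
  using k
proof (induction k rule: dec_induct)
  case base
  then show ?case using cumul_pos[OF pos, of 1] by simp
next
  case (step k)
  have "cumul a k > 0" "cumul a (Suc k) > 0"
    using step cumul_pos[OF pos] by auto
  moreover have "1 - \<gamma> (Suc k) = cumul a k / cumul a (Suc k)"
    using \<gamma>[of "Suc k"] step(1) \<open>cumul a (Suc k) > 0\<close> by (simp add: cumul_Suc field_simps)
  ultimately show ?case using step by (simp add: prod.nat_ivl_Suc')
qed

lemma mu_agd_plus_iterates_in:
  assumes "convex X" "mu_agd_plus X \<psi> \<mu> a g \<eta> x y v"
  shows "v k \<in> X" "y k \<in> X" "k \<ge> 1 \<Longrightarrow> x k \<in> X"
proof -
  note alg = assms(2)[unfolded mu_agd_plus_def Let_def]
  have pos: "\<forall>k\<ge>1. a k > 0" using alg by blast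
  have v: "v k \<in> X" for k
    using alg by (cases "k = 0") (auto simp: is_arg_min_def)
  \<comment> \<open>With step ratios in [0,1], both \<open>y\<close> and \<open>x\<close> are formed
    by convex combinations of points of \<open>X\<close>.\<close>
  have \<theta>: "0 \<le> a k / cumul a k \<and> a k / cumul a k \<le> 1" if "k \<ge> 1" for k
  proof -
    have "a k \<le> cumul a k"
      unfolding cumul_def using pos that by (intro member_le_sum) (auto intro: less_imp_le)
    then show ?thesis using cumul_pos[OF pos that] pos that by (simp add: less_imp_le)
  qed
  have y: "y k \<in> X" for k
  proof (induction k)
    case 0
    then show ?case using alg by auto
  next
    case (Suc k)
    have "y (Suc k) = (1 - a (Suc k) / cumul a (Suc k)) *\<^sub>R y k
        + (a (Suc k) / cumul a (Suc k)) *\<^sub>R v (Suc k)"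
      using alg by (metis diff_Suc_1 le_add1 plus_1_eq_Suc)
    then show ?case
      using assms(1) Suc v \<theta>[of "Suc k"] by (simp add: convex_alt)
  qed
  show "v k \<in> X" "y k \<in> X" by (fact v y)+
  show "x k \<in> X" if "k \<ge> 1"
  proof -
    define t where "t = a k / cumul a k"
    have "x k = (1 / (1 + t)) *\<^sub>R y (k - 1) + (t / (1 + t)) *\<^sub>R v (k - 1)"
      unfolding t_def using alg that by blast
    moreover have "1 / (1 + t) + t / (1 + t) = 1" "0 \<le> 1 / (1 + t)" "0 \<le> t / (1 + t)"
      using \<theta>[OF that, folded t_def] by (simp_all flip: add_divide_distrib)
    ultimately show ?thesis using assms(1) y v by (simp add: convexD)
  qed
qed

lemma mu_agd_plus_upper_bound:
  assumes X: "convex X" and \<mu>: "0 < \<mu>" "\<mu> \<le> L"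
    and smooth: "smooth_fun_on L X f g" and sc: "strongly_convex_fun_on \<mu> X f g"
    and \<psi>: "\<And>z. \<psi> z = (L - \<mu>) / 2 * (norm z)\<^sup>2"
    and a1: "a 1 = 1"
    and \<theta>: "\<And>i. i \<ge> 2 \<Longrightarrow> a i / cumul a i \<le> sqrt (\<mu> / L)"
    and agd: "mu_agd_plus X \<psi> \<mu> a g \<eta> x y v"
    and k: "k \<ge> 1"
  shows "cumul a k * f (y k) \<le> agd_model \<psi> \<mu> a (\<lambda>i. g (x i) + \<eta> i) x k (v k)
    + (\<Sum>i=1..k. a i * (f (x i) - \<eta> i \<bullet> (v i - x i)))"
  using k
proof (induction k rule: dec_induct)
  note alg = agd[unfolded mu_agd_plus_def Let_def]
  note iterates_in = mu_agd_plus_iterates_in[OF X agd]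
  {
    case base
    \<comment> \<open>The step-size bound starts at index 2, so the first step is treated directly.
      Its ratio is 1, and as \<open>x 1 = x 0\<close> the curvatures \<open>\<mu>\<close> and
      \<open>L - \<mu>\<close> add up to \<open>L\<close>: the claim is exactly smoothness at
      \<open>x 1\<close>.\<close>
    have c: "cumul a 1 = 1" using a1 by (simp add: cumul_def)
    have y: "y 1 = v 1" and x: "x 1 = x 0"
      using alg a1 c by auto
    have "f (v 1) \<le> f (x 1) + g (x 1) \<bullet> (v 1 - x 1) + L / 2 * (norm (v 1 - x 1))\<^sup>2"
      using smooth iterates_in(1)[of 1] iterates_in(3)[of 1] by (auto simp: smooth_fun_on_def)
    then show ?case
      using a1 x y c
      by (simp add: agd_model_def bregman_half_norm_squared[of \<psi>, OF \<psi>] inner_simps field_simps)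
  next
    case (step k)
    let ?m = "agd_model \<psi> \<mu> a (\<lambda>i. g (x i) + \<eta> i) x"
    define n where "n = Suc k"
    have n: "n \<ge> 2" "n \<ge> 1" "n - 1 = k" using step by (auto simp: n_def)
    have pos: "\<forall>k\<ge>1. a k > 0" using alg by blast
    have A: "cumul a k > 0" "cumul a n = cumul a k + a n"
      using cumul_pos[OF pos step(1)] by (auto simp: n_def cumul_Suc)
    define t where "t = a n / (cumul a k + a n)"
    have an: "a n > 0" using pos n by blast
    have "t \<le> sqrt (\<mu> / L)" using \<theta>[OF n(1)] A t_def by simp
    moreover have "0 \<le> t" using A an by (simp add: t_def)
    ultimately have "t\<^sup>2 \<le> \<mu> / L"
      using \<mu> by (metis real_sqrt_le_iff real_sqrt_unique sqrt_le_D abs_of_nonneg real_sqrt_abs)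
    then have Lt: "L * t\<^sup>2 \<le> \<mu>" using \<mu> by (simp add: field_simps)
    have "x n = (1 / (1 + t)) *\<^sub>R y k + (t / (1 + t)) *\<^sub>R v k"
      and "y n = (1 - t) *\<^sub>R y k + t *\<^sub>R v n"
      unfolding t_def A(2)[symmetric] using alg n by auto
    from agd_function_decrease[OF smooth sc _ _ _ _ _ an t_def Lt this] have "cumul a n * f (y n) \<le> cumul a k * f (y k)
        + a n * (f (x n) + g (x n) \<bullet> (v n - x n) + \<mu> / 2 * (norm (v n - x n))\<^sup>2)
        + cumul a k * \<mu> / 2 * (norm (v n - v k))\<^sup>2"
      using iterates_in n \<mu> A by simp
    \<comment> \<open>The part \<open>cumul a k * \<mu>\<close> of the curvature cancels the term in
      \<open>v n - v k\<close> above; the rest, with factor \<open>L - \<mu>\<close>, is nonnegative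
      and is dropped.\<close>
    moreover have "?m k (v k) + (cumul a k * \<mu> + (L - \<mu>)) / 2 * (norm (v n - v k))\<^sup>2 \<le> ?m k (v n)"
      using alg step(1) iterates_in(1)
      by (intro argmin_quadratic_growth[OF X] agd_model_affine_combination \<psi>) auto
    moreover have "0 \<le> (L - \<mu>) / 2 * (norm (v n - v k))\<^sup>2" using \<mu> by simp
    moreover have "?m n (v n) = ?m k (v n)
        + a n * ((g (x n) + \<eta> n) \<bullet> (v n - x n) + \<mu> / 2 * (norm (v n - x n))\<^sup>2)"
      by (simp add: n_def agd_model_Suc)
    moreover have "(\<Sum>i=1..n. a i * (f (x i) - \<eta> i \<bullet> (v i - x i)))
        = (\<Sum>i=1..k. a i * (f (x i) - \<eta> i \<bullet> (v i - x i))) + a n * (f (x n) - \<eta> n \<bullet> (v n - x n))"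
      by (simp add: n_def)
    ultimately show ?case
      using step(3) unfolding n_def[symmetric]
      by (simp add: inner_add_left algebra_simps add_divide_distrib diff_divide_distrib)
  }
qed

theorem theorem6p4:
  fixes X :: "(real^'n) set"
    and f \<psi> :: "real^'n \<Rightarrow> real"
    and g :: "real^'n \<Rightarrow> real^'n"
    and L \<mu> :: real
    and a \<gamma> :: "nat \<Rightarrow> real"
    and \<eta> x y v :: "nat \<Rightarrow> real^'n"
    and xstar :: "real^'n"
  assumes "closed X" and "convex X"
    and "0 < \<mu>" and "\<mu> \<le> L"
    and "cont_diff_on X f g"
    and "smooth_fun_on L X f g"
    and "strongly_convex_fun_on \<mu> X f g"
    and "is_arg_min f (\<lambda>z. z \<in> X) xstar"
    and "\<And>z. \<psi> z = (L - \<mu>) / 2 * (norm z)\<^sup>2"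
    and "a 1 = 1"
    and "\<And>i. i \<ge> 2 \<Longrightarrow> a i / cumul a i = \<gamma> i"
    and "\<And>i. i \<ge> 2 \<Longrightarrow> \<gamma> i \<le> sqrt (\<mu> / L)"
    and "mu_agd_plus X \<psi> \<mu> a g \<eta> x y v"
  shows "\<forall>k\<ge>1.
      f (y k) - f xstar
        \<le> cumul a 1 / cumul a k * ((L - \<mu>) * (norm (xstar - x 0))\<^sup>2 / 2)
          + (\<Sum>i=1..k. a i * (\<eta> i \<bullet> (xstar - v i))) / cumul a k
    \<and> cumul a 1 / cumul a k * ((L - \<mu>) * (norm (xstar - x 0))\<^sup>2 / 2)
          + (\<Sum>i=1..k. a i * (\<eta> i \<bullet> (xstar - v i))) / cumul a k
        \<le> (\<Prod>i=2..k. (1 - \<gamma> i)) * ((L - \<mu>) * (norm (xstar - x 0))\<^sup>2 / 2)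
          + (\<Sum>i=1..k. a i * (\<eta> i \<bullet> (xstar - v i))) / cumul a k"
proof (intro allI impI)
  fix k :: nat
  assume k: "k \<ge> 1"
  let ?m = "agd_model \<psi> \<mu> a (\<lambda>i. g (x i) + \<eta> i) x"
  let ?D = "(L - \<mu>) * (norm (xstar - x 0))\<^sup>2 / 2"
  let ?E = "\<Sum>i=1..k. a i * (\<eta> i \<bullet> (xstar - v i))"
  note alg = assms(13)[unfolded mu_agd_plus_def Let_def]
  note iterates_in = mu_agd_plus_iterates_in[OF assms(2,13)]
  have pos: "\<forall>k\<ge>1. a k > 0" using alg by blast
  have A: "cumul a k > 0" using cumul_pos[OF pos k] .
  have A1: "cumul a 1 = 1" using assms(10) by (simp add: cumul_def)
  have xs: "xstar \<in> X" using assms(8) by (simp add: is_arg_min_def)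
  have "cumul a k * f (y k) \<le> ?m k (v k) + (\<Sum>i=1..k. a i * (f (x i) - \<eta> i \<bullet> (v i - x i)))"
    by (rule mu_agd_plus_upper_bound) (use assms k in auto)
  also have "?m k (v k) \<le> ?m k xstar"
    using alg k xs by (auto simp: is_arg_min_def not_less)
  \<comment> \<open>The oracle error enters the model through \<open>xstar - x i\<close> and the
    correction sum through \<open>v i - x i\<close>; their difference is \<open>xstar - v i\<close>.
    The Bregman term becomes \<open>?D\<close>.\<close>
  also have "?m k xstar + (\<Sum>i=1..k. a i * (f (x i) - \<eta> i \<bullet> (v i - x i)))
      = (\<Sum>i=1..k. a i * (f (x i) + g (x i) \<bullet> (xstar - x i) + \<mu> / 2 * (norm (xstar - x i))\<^sup>2)
          + a i * (\<eta> i \<bullet> (xstar - v i))) + ?D"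
    unfolding agd_model_def bregman_half_norm_squared[of \<psi>, OF assms(9)]
    by (simp add: inner_simps algebra_simps flip: sum.distrib)
  \<comment> \<open>Each summand without its error term is the strong convexity lower bound for
    \<open>f xstar\<close> taken at \<open>x i\<close>.\<close>
  also have "\<dots> \<le> (\<Sum>i=1..k. a i * f xstar + a i * (\<eta> i \<bullet> (xstar - v i))) + ?D"
    using assms(7) iterates_in(3) xs pos
    by (intro add_right_mono sum_mono mult_left_mono) (auto simp: strongly_convex_fun_on_def less_imp_le)
  also have "\<dots> = cumul a k * f xstar + ?E + ?D"
    by (simp add: cumul_def sum.distrib sum_distrib_right)
  finally have "cumul a k * (f (y k) - f xstar) \<le> ?D + ?E"
    by (simp add: algebra_simps)
  then have "f (y k) - f xstar \<le> (?D + ?E) / cumul a k"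
    using A by (simp add: pos_le_divide_eq mult.commute)
  then have "f (y k) - f xstar \<le> cumul a 1 / cumul a k * ?D + ?E / cumul a k"
    unfolding A1 by (simp add: add_divide_distrib)
  moreover have "(\<Prod>i=2..k. (1 - \<gamma> i)) = cumul a 1 / cumul a k"
    using prod_one_minus_ratio_cumul[OF pos k assms(11)] .
  ultimately show "f (y k) - f xstar \<le> cumul a 1 / cumul a k * ?D + ?E / cumul a k
      \<and> cumul a 1 / cumul a k * ?D + ?E / cumul a k
        \<le> (\<Prod>i=2..k. (1 - \<gamma> i)) * ?D + ?E / cumul a k"
    by simp
qed

end
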